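(* Let $(g,d,f,\xi)$ be an optimal solution of the SC-ST clearing problem and let $(\pi,\overline{\lambda})$ be an optimal solution of its dual problem. Then, at the prices $\pi$, the allocation $(g,d,f,\xi)$ maximizes the collective stakeholder profit $$\sum_{i\in\mathcal{G}}\phi^g_i+\sum_{j\in\mathcal{D}}\phi^d_j+\sum_{l\in\mathcal{L}}\phi^f_l+\sum_{m\in\mathcal{M}}\phi^\xi_m$$ over all allocations satisfying the capacity limits $0\le g_i\le\overline{g}_i$, $0\le d_j\le\overline{d}_j$, $0\le f_l\le\overline{f}_l$, $0\le\xi_m\le\overline{\xi}_m$. Moreover, all profits of the solution are nonnegative: $\phi^g_i\ge0$ for all $i\in\mathcal{G}$, $\phi^d_j\ge0$ for all $j\in\mathcal{D}$, $\phi^f_l\ge0$ for all $l\in\mathcal{L}$, $\phi^\xi_m\ge0$ for all $m\in\mathcal{M}$.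
   Context: Setting (space-time supply chain, SC-ST). $\mathcal{N}$ is a finite set of spatial nodes, $\mathcal{T}$ a finite ordered set of times, $\mathcal{S}=\mathcal{N}\times\mathcal{T}$ the set of space-time nodes $s=(n,t)$, $\mathcal{P}$ a finite set of products. There are finite sets of stakeholders (players): suppliers $\mathcal{G}$, consumers $\mathcal{D}$, transport providers $\mathcal{L}$, technology providers $\mathcal{M}$. - Supplier $i$: node $s(i)\in\mathcal{S}$, product $p(i)\in\mathcal{P}$, flow $g_i\ge0$, capacity $\overline{g}_i\ge0$, bid $\alpha^g_i\in\mathbb{R}$. - Consumer $j$: node $s(j)\in\mathcal{S}$, product $p(j)\in\mathcal{P}$, flow $d_j\ge0$, capacity $\overline{d}_j\ge0$, bid $\alpha^d_j\in\mathbb{R}$. - Transport provider $l$: base node $s_b(l)\in\mathcal{S}$, receiving node $s_r(l)\in\mathcal{S}$, product $p(l)\in\mathcal{P}$, flow $f_l\ge0$, capacity $\overline{f}_l\ge0$, bid $\alpha^f_l\ge0$. - Technology provider $m$: node $s(m)\in\mathcal{S}$, sets $\mathcal{P}^{con}_m,\mathcal{P}^{gen}_m\subset\mathcal{P}$ of consumed and generated products, yields $\gamma_{m,p}\ge0$ with $\gamma_{m,\bar p_m}=1$ for a reference product $\bar p_m\in\mathcal{P}^{con}_m$, flow $\xi_m\ge0$, capacity $\overline{\xi}_m\ge0$, bid $\alpha^\xi_m\ge0$. For $(s,p)\in\mathcal{S}\times\mathcal{P}$: $\mathcal{G}_{s,p}=\{i:s(i)=s,p(i)=p\}$, $\mathcal{D}_{s,p}=\{j:s(j)=s,p(j)=p\}$,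 $\mathcal{L}^{in}_{s,p}=\{l:s_r(l)=s,p(l)=p\}$, $\mathcal{L}^{out}_{s,p}=\{l:s_b(l)=s,p(l)=p\}$, $\mathcal{M}^{con}_{s,p}=\{m:s(m)=s,p\in\mathcal{P}^{con}_m\}$, $\mathcal{M}^{gen}_{s,p}=\{m:s(m)=s,p\in\mathcal{P}^{gen}_m\}$. SC-ST clearing problem (primal): maximize $\sum_j\alpha^d_jd_j-\sum_i\alpha^g_ig_i-\sum_l\alpha^f_lf_l-\sum_m\alpha^\xi_m\xi_m$ over nonnegative $(g,d,f,\xi)$ subject to the clearing constraints, for all $(s,p)\in\mathcal{S}\times\mathcal{P}$ (dual variable $\pi_{s,p}\in\mathbb{R}$, the clearing price), $$\sum_{i\in\mathcal{G}_{s,p}}g_i+\sum_{l\in\mathcal{L}^{in}_{s,p}}f_l+\sum_{m\in\mathcal{M}^{gen}_{s,p}}\gamma_{m,p}\xi_m=\sum_{j\in\mathcal{D}_{s,p}}d_j+\sum_{l\in\mathcal{L}^{out}_{s,p}}f_l+\sum_{m\in\mathcal{M}^{con}_{s,p}}\gamma_{m,p}\xi_m,$$ and capacity constraints $g_i\le\overline{g}_i$, $d_j\le\overline{d}_j$, $f_l\le\overline{f}_l$, $\xi_m\le\overline{\xi}_m$ (dual variables $\overline{\lambda}_i,\overline{\lambda}_j,\overline{\lambda}_l,\overline{\lambda}_m\ge0$). Stakeholder prices: $\pi_i=\pi_{s(i),p(i)}$, $\pi_j=\pi_{s(j),p(j)}$, $\pi_l=\pi_{s_r(l),p(l)}-\pi_{s_b(l),p(l)}$,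 $\pi_m=\sum_{p\in\mathcal{P}^{gen}_m}\gamma_{m,p}\pi_{s(m),p}-\sum_{p\in\mathcal{P}^{con}_m}\gamma_{m,p}\pi_{s(m),p}$. Dual problem: minimize $\sum_i\overline{g}_i\overline{\lambda}_i+\sum_j\overline{d}_j\overline{\lambda}_j+\sum_l\overline{f}_l\overline{\lambda}_l+\sum_m\overline{\xi}_m\overline{\lambda}_m$ over $\pi$ (free) and $\overline{\lambda}\ge0$ subject to $\pi_i-\overline{\lambda}_i\le\alpha^g_i$, $\pi_j+\overline{\lambda}_j\ge\alpha^d_j$, $\pi_l-\overline{\lambda}_l\le\alpha^f_l$, $\pi_m-\overline{\lambda}_m\le\alpha^\xi_m$ for all players. Profits: $\phi^g_i=(\pi_i-\alpha^g_i)g_i$, $\phi^d_j=(\alpha^d_j-\pi_j)d_j$, $\phi^f_l=(\pi_l-\alpha^f_l)f_l$, $\phi^\xi_m=(\pi_m-\alpha^\xi_m)\xi_m$. *)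

theory Defs
  imports Complex_Main
begin

text \<open>Space-time supply chain market.  The prefix \<open>con_\<close> refers to consumers (stakeholders), whereas
  \<open>tec_con\<close> and \<open>tec_gen\<close> are the product sets consumed and generated by a technology, and
  \<open>tec_ref\<close> is the reference product to which its flow, capacity and bid refer.\<close>

record ('n, 't, 'p, 'g, 'd, 'l, 'm) scst_data =
  spatial_nodes :: "'n set"
  times :: "'t::linorder set"
  products :: "'p set"

  suppliers :: "'g set"
  sup_node :: "'g \<Rightarrow> 'n \<times> 't"
  sup_prod :: "'g \<Rightarrow> 'p"
  sup_cap :: "'g \<Rightarrow> real"
  sup_bid :: "'g \<Rightarrow> real"

  consumers :: "'d set"
  con_node :: "'d \<Rightarrow> 'n \<times> 't"
  con_prod :: "'d \<Rightarrow> 'p"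
  con_cap :: "'d \<Rightarrow> real"
  con_bid :: "'d \<Rightarrow> real"

  transports :: "'l set"
  base_node :: "'l \<Rightarrow> 'n \<times> 't"
  recv_node :: "'l \<Rightarrow> 'n \<times> 't"
  tra_prod :: "'l \<Rightarrow> 'p"
  tra_cap :: "'l \<Rightarrow> real"
  tra_bid :: "'l \<Rightarrow> real"

  technologies :: "'m set"
  tec_node :: "'m \<Rightarrow> 'n \<times> 't"
  tec_con :: "'m \<Rightarrow> 'p set"
  tec_gen :: "'m \<Rightarrow> 'p set"
  tec_ref :: "'m \<Rightarrow> 'p"
  tec_yield :: "'m \<Rightarrow> 'p \<Rightarrow> real"
  tec_cap :: "'m \<Rightarrow> real"
  tec_bid :: "'m \<Rightarrow> real"

definition st_nodes :: "('n, 't::linorder, 'p, 'g, 'd, 'l, 'm) scst_data \<Rightarrow> ('n \<times> 't) set" where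
  "st_nodes M = spatial_nodes M \<times> times M"

locale scst =
  fixes M :: "('n, 't::linorder, 'p, 'g, 'd, 'l, 'm) scst_data"
  assumes finite_spatial_nodes: "finite (spatial_nodes M)"
    and finite_times: "finite (times M)"
    and finite_products: "finite (products M)"
    and finite_suppliers: "finite (suppliers M)"
    and finite_consumers: "finite (consumers M)"
    and finite_transports: "finite (transports M)"
    and finite_technologies: "finite (technologies M)"
    and sup_node_in: "i \<in> suppliers M \<Longrightarrow> sup_node M i \<in> st_nodes M"
    and sup_prod_in: "i \<in> suppliers M \<Longrightarrow> sup_prod M i \<in> products M"
    and sup_cap_nonneg: "i \<in> suppliers M \<Longrightarrow> 0 \<le> sup_cap M i"
    and con_node_in: "j \<in> consumers M \<Longrightarrow> con_node M j \<in> st_nodes M"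
    and con_prod_in: "j \<in> consumers M \<Longrightarrow> con_prod M j \<in> products M"
    and con_cap_nonneg: "j \<in> consumers M \<Longrightarrow> 0 \<le> con_cap M j"
    and base_node_in: "l \<in> transports M \<Longrightarrow> base_node M l \<in> st_nodes M"
    and recv_node_in: "l \<in> transports M \<Longrightarrow> recv_node M l \<in> st_nodes M"
    and tra_prod_in: "l \<in> transports M \<Longrightarrow> tra_prod M l \<in> products M"
    and tra_cap_nonneg: "l \<in> transports M \<Longrightarrow> 0 \<le> tra_cap M l"
    and tra_bid_nonneg: "l \<in> transports M \<Longrightarrow> 0 \<le> tra_bid M l"
    and tec_node_in: "m \<in> technologies M \<Longrightarrow> tec_node M m \<in> st_nodes M"
    and tec_con_subset: "m \<in> technologies M \<Longrightarrow> tec_con M m \<subseteq> products M"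
    and tec_gen_subset: "m \<in> technologies M \<Longrightarrow> tec_gen M m \<subseteq> products M"
    and tec_ref_in: "m \<in> technologies M \<Longrightarrow> tec_ref M m \<in> tec_con M m"
    and tec_yield_ref: "m \<in> technologies M \<Longrightarrow> tec_yield M m (tec_ref M m) = 1"
    and tec_yield_nonneg:
      "m \<in> technologies M \<Longrightarrow> p \<in> tec_con M m \<union> tec_gen M m \<Longrightarrow> 0 \<le> tec_yield M m p"
    and tec_cap_nonneg: "m \<in> technologies M \<Longrightarrow> 0 \<le> tec_cap M m"
    and tec_bid_nonneg: "m \<in> technologies M \<Longrightarrow> 0 \<le> tec_bid M m"

definition sup_at ::
  "('n, 't::linorder, 'p, 'g, 'd, 'l, 'm) scst_data \<Rightarrow> 'n \<times> 't \<Rightarrow> 'p \<Rightarrow> 'g set" where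
  "sup_at M s p = {i \<in> suppliers M. sup_node M i = s \<and> sup_prod M i = p}"

definition con_at ::
  "('n, 't::linorder, 'p, 'g, 'd, 'l, 'm) scst_data \<Rightarrow> 'n \<times> 't \<Rightarrow> 'p \<Rightarrow> 'd set" where
  "con_at M s p = {j \<in> consumers M. con_node M j = s \<and> con_prod M j = p}"

definition tra_in ::
  "('n, 't::linorder, 'p, 'g, 'd, 'l, 'm) scst_data \<Rightarrow> 'n \<times> 't \<Rightarrow> 'p \<Rightarrow> 'l set" where
  "tra_in M s p = {l \<in> transports M. recv_node M l = s \<and> tra_prod M l = p}"

definition tra_out ::
  "('n, 't::linorder, 'p, 'g, 'd, 'l, 'm) scst_data \<Rightarrow> 'n \<times> 't \<Rightarrow> 'p \<Rightarrow> 'l set" where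
  "tra_out M s p = {l \<in> transports M. base_node M l = s \<and> tra_prod M l = p}"

definition tec_con_at ::
  "('n, 't::linorder, 'p, 'g, 'd, 'l, 'm) scst_data \<Rightarrow> 'n \<times> 't \<Rightarrow> 'p \<Rightarrow> 'm set" where
  "tec_con_at M s p = {m \<in> technologies M. tec_node M m = s \<and> p \<in> tec_con M m}"

definition tec_gen_at ::
  "('n, 't::linorder, 'p, 'g, 'd, 'l, 'm) scst_data \<Rightarrow> 'n \<times> 't \<Rightarrow> 'p \<Rightarrow> 'm set" where
  "tec_gen_at M s p = {m \<in> technologies M. tec_node M m = s \<and> p \<in> tec_gen M m}"

text \<open>Flows, multipliers and prices are total functions; only their values on the players of
  the market, respectively on \<^term>\<open>st_nodes M \<times> products M\<close>, are ever used.\<close>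

record ('g, 'd, 'l, 'm) allocation =
  sup_flow :: "'g \<Rightarrow> real"
  con_flow :: "'d \<Rightarrow> real"
  tra_flow :: "'l \<Rightarrow> real"
  tec_flow :: "'m \<Rightarrow> real"

record ('g, 'd, 'l, 'm) multipliers =
  sup_mult :: "'g \<Rightarrow> real"
  con_mult :: "'d \<Rightarrow> real"
  tra_mult :: "'l \<Rightarrow> real"
  tec_mult :: "'m \<Rightarrow> real"

type_synonym ('n, 't, 'p) prices = "'n \<times> 't \<Rightarrow> 'p \<Rightarrow> real"

definition within_capacity ::
  "('n, 't::linorder, 'p, 'g, 'd, 'l, 'm) scst_data \<Rightarrow> ('g, 'd, 'l, 'm) allocation \<Rightarrow> bool" where
  "within_capacity M x \<longleftrightarrow>
     (\<forall>i\<in>suppliers M. 0 \<le> sup_flow x i \<and> sup_flow x i \<le> sup_cap M i) \<and>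
     (\<forall>j\<in>consumers M. 0 \<le> con_flow x j \<and> con_flow x j \<le> con_cap M j) \<and>
     (\<forall>l\<in>transports M. 0 \<le> tra_flow x l \<and> tra_flow x l \<le> tra_cap M l) \<and>
     (\<forall>m\<in>technologies M. 0 \<le> tec_flow x m \<and> tec_flow x m \<le> tec_cap M m)"

definition clears ::
  "('n, 't::linorder, 'p, 'g, 'd, 'l, 'm) scst_data \<Rightarrow> ('g, 'd, 'l, 'm) allocation \<Rightarrow> bool" where
  "clears M x \<longleftrightarrow>
     (\<forall>s\<in>st_nodes M. \<forall>p\<in>products M.
        (\<Sum>i\<in>sup_at M s p. sup_flow x i) + (\<Sum>l\<in>tra_in M s p. tra_flow x l)
          + (\<Sum>m\<in>tec_gen_at M s p. tec_yield M m p * tec_flow x m)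
        = (\<Sum>j\<in>con_at M s p. con_flow x j) + (\<Sum>l\<in>tra_out M s p. tra_flow x l)
          + (\<Sum>m\<in>tec_con_at M s p. tec_yield M m p * tec_flow x m))"

definition primal_feasible ::
  "('n, 't::linorder, 'p, 'g, 'd, 'l, 'm) scst_data \<Rightarrow> ('g, 'd, 'l, 'm) allocation \<Rightarrow> bool" where
  "primal_feasible M x \<longleftrightarrow> within_capacity M x \<and> clears M x"

definition primal_objective ::
  "('n, 't::linorder, 'p, 'g, 'd, 'l, 'm) scst_data \<Rightarrow> ('g, 'd, 'l, 'm) allocation \<Rightarrow> real" where
  "primal_objective M x =
     (\<Sum>j\<in>consumers M. con_bid M j * con_flow x j)
     - (\<Sum>i\<in>suppliers M. sup_bid M i * sup_flow x i)
     - (\<Sum>l\<in>transports M. tra_bid M l * tra_flow x l)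
     - (\<Sum>m\<in>technologies M. tec_bid M m * tec_flow x m)"

definition primal_optimal ::
  "('n, 't::linorder, 'p, 'g, 'd, 'l, 'm) scst_data \<Rightarrow> ('g, 'd, 'l, 'm) allocation \<Rightarrow> bool" where
  "primal_optimal M = is_arg_max (primal_objective M) (primal_feasible M)"

definition sup_price ::
  "('n, 't::linorder, 'p, 'g, 'd, 'l, 'm) scst_data \<Rightarrow> ('n, 't, 'p) prices \<Rightarrow> 'g \<Rightarrow> real" where
  "sup_price M \<pi> i = \<pi> (sup_node M i) (sup_prod M i)"

definition con_price ::
  "('n, 't::linorder, 'p, 'g, 'd, 'l, 'm) scst_data \<Rightarrow> ('n, 't, 'p) prices \<Rightarrow> 'd \<Rightarrow> real" where
  "con_price M \<pi> j = \<pi> (con_node M j) (con_prod M j)"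

definition tra_price ::
  "('n, 't::linorder, 'p, 'g, 'd, 'l, 'm) scst_data \<Rightarrow> ('n, 't, 'p) prices \<Rightarrow> 'l \<Rightarrow> real" where
  "tra_price M \<pi> l = \<pi> (recv_node M l) (tra_prod M l) - \<pi> (base_node M l) (tra_prod M l)"

definition tec_price ::
  "('n, 't::linorder, 'p, 'g, 'd, 'l, 'm) scst_data \<Rightarrow> ('n, 't, 'p) prices \<Rightarrow> 'm \<Rightarrow> real" where
  "tec_price M \<pi> m =
     (\<Sum>p\<in>tec_gen M m. tec_yield M m p * \<pi> (tec_node M m) p)
     - (\<Sum>p\<in>tec_con M m. tec_yield M m p * \<pi> (tec_node M m) p)"

definition dual_feasible ::
  "('n, 't::linorder, 'p, 'g, 'd, 'l, 'm) scst_data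
     \<Rightarrow> ('n, 't, 'p) prices \<times> ('g, 'd, 'l, 'm) multipliers \<Rightarrow> bool" where
  "dual_feasible M = (\<lambda>(\<pi>, y).
     (\<forall>i\<in>suppliers M. 0 \<le> sup_mult y i \<and> sup_price M \<pi> i - sup_mult y i \<le> sup_bid M i) \<and>
     (\<forall>j\<in>consumers M. 0 \<le> con_mult y j \<and> con_price M \<pi> j + con_mult y j \<ge> con_bid M j) \<and>
     (\<forall>l\<in>transports M. 0 \<le> tra_mult y l \<and> tra_price M \<pi> l - tra_mult y l \<le> tra_bid M l) \<and>
     (\<forall>m\<in>technologies M. 0 \<le> tec_mult y m \<and> tec_price M \<pi> m - tec_mult y m \<le> tec_bid M m))"

definition dual_objective ::
  "('n, 't::linorder, 'p, 'g, 'd, 'l, 'm) scst_data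
     \<Rightarrow> ('n, 't, 'p) prices \<times> ('g, 'd, 'l, 'm) multipliers \<Rightarrow> real" where
  "dual_objective M = (\<lambda>(\<pi>, y).
     (\<Sum>i\<in>suppliers M. sup_cap M i * sup_mult y i)
     + (\<Sum>j\<in>consumers M. con_cap M j * con_mult y j)
     + (\<Sum>l\<in>transports M. tra_cap M l * tra_mult y l)
     + (\<Sum>m\<in>technologies M. tec_cap M m * tec_mult y m))"

definition dual_optimal ::
  "('n, 't::linorder, 'p, 'g, 'd, 'l, 'm) scst_data
     \<Rightarrow> ('n, 't, 'p) prices \<times> ('g, 'd, 'l, 'm) multipliers \<Rightarrow> bool" where
  "dual_optimal M = is_arg_min (dual_objective M) (dual_feasible M)"

definition sup_profit ::
  "('n, 't::linorder, 'p, 'g, 'd, 'l, 'm) scst_data \<Rightarrow> ('n, 't, 'p) prices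
     \<Rightarrow> ('g, 'd, 'l, 'm) allocation \<Rightarrow> 'g \<Rightarrow> real" where
  "sup_profit M \<pi> x i = (sup_price M \<pi> i - sup_bid M i) * sup_flow x i"

definition con_profit ::
  "('n, 't::linorder, 'p, 'g, 'd, 'l, 'm) scst_data \<Rightarrow> ('n, 't, 'p) prices
     \<Rightarrow> ('g, 'd, 'l, 'm) allocation \<Rightarrow> 'd \<Rightarrow> real" where
  "con_profit M \<pi> x j = (con_bid M j - con_price M \<pi> j) * con_flow x j"

definition tra_profit ::
  "('n, 't::linorder, 'p, 'g, 'd, 'l, 'm) scst_data \<Rightarrow> ('n, 't, 'p) prices
     \<Rightarrow> ('g, 'd, 'l, 'm) allocation \<Rightarrow> 'l \<Rightarrow> real" where
  "tra_profit M \<pi> x l = (tra_price M \<pi> l - tra_bid M l) * tra_flow x l"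

definition tec_profit ::
  "('n, 't::linorder, 'p, 'g, 'd, 'l, 'm) scst_data \<Rightarrow> ('n, 't, 'p) prices
     \<Rightarrow> ('g, 'd, 'l, 'm) allocation \<Rightarrow> 'm \<Rightarrow> real" where
  "tec_profit M \<pi> x m = (tec_price M \<pi> m - tec_bid M m) * tec_flow x m"

definition collective_profit ::
  "('n, 't::linorder, 'p, 'g, 'd, 'l, 'm) scst_data \<Rightarrow> ('n, 't, 'p) prices
     \<Rightarrow> ('g, 'd, 'l, 'm) allocation \<Rightarrow> real" where
  "collective_profit M \<pi> x =
     (\<Sum>i\<in>suppliers M. sup_profit M \<pi> x i)
     + (\<Sum>j\<in>consumers M. con_profit M \<pi> x j)
     + (\<Sum>l\<in>transports M. tra_profit M \<pi> x l)
     + (\<Sum>m\<in>technologies M. tec_profit M \<pi> x m)"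

end

theory Submission
  imports Defs "HOL-Library.Function_Algebras"
begin

text \<open>
  The collective profit at prices \<open>\<pi>\<close> is the Lagrangian of the clearing problem: it is the primal
  objective plus the net supplies priced at \<open>\<pi>\<close>, so on allocations that clear the market the
  two agree, whatever \<open>\<pi>\<close> is (\<open>collective_profit_of_clearing\<close>).  On all allocations within capacity
  it is bounded by the objective of any dual feasible point (\<open>collective_profit_le_dual\<close>), as a
  player with margin \<open>r\<close>, multiplier \<open>u \<ge> max 0 r\<close> and capacity \<open>c\<close> earns at most \<open>c * u\<close>.
  If the dual optimum equals the primal optimum, the optimal clearing allocation attains this
  bound and hence maximizes the collective profit.  No profit can then be negative, because the
  capacity limits of different players are independent: idling one player would be an
  improvement (\<open>profit_nonneg\<close>).

  What remains is strong duality (\<open>dual_attains_primal\<close>).  At an optimal allocation no direction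
  that preserves clearing and points into the capacity box increases the objective.
  Farkas' lemma turns this into prices at which every player with a positive margin runs at
  capacity and every player with a negative margin is idle (\<open>box_lp_multipliers\<close>).  With
  the positive parts of the margins as multipliers, these prices form a dual feasible point whose
  objective is the primal optimum.

  The four kinds of stakeholders behave alike in all of this, so they are merged into one
  type of players, for which the market becomes a linear program over a box.
\<close>

section \<open>Farkas' lemma\<close>

text \<open>
  Farkas' lemma for finitely many linear functionals on an arbitrary vector space over an ordered
  field, where the indices in \<open>E\<close> stand for equations, whose coefficients have free sign.  This is
  Bartl's algebraic induction.  When a constraint \<open>a j\<close> is added, either it is redundant, or there
  is a vector \<open>w\<close> that obeys the other constraints and has \<open>b w > 0\<close>.  Since \<open>w\<close> must then violate
  \<open>a j\<close>, every vector can be moved along \<open>w\<close> into the kernel of \<open>a j\<close>, and on that kernel \<open>a j\<close>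
  is no longer a constraint.  Working with functionals rather than with a polyhedral cone avoids any
  appeal to closedness or dimension.
\<close>

lemma farkas:
  fixes scale :: "'f::linordered_field \<Rightarrow> 'v::ab_group_add \<Rightarrow> 'v"
  assumes "finite I"
    and "\<And>i. i \<in> I \<Longrightarrow> Vector_Spaces.linear scale (*) (a i)"
    and "Vector_Spaces.linear scale (*) b"
    and "\<And>v. (\<forall>i\<in>I. a i v \<le> 0 \<and> (i \<in> E \<longrightarrow> a i v = 0)) \<Longrightarrow> b v \<le> 0"
  shows "\<exists>c. (\<forall>i\<in>I - E. 0 \<le> c i) \<and> (\<forall>v. b v = (\<Sum>i\<in>I. c i * a i v))"
  using assms
proof (induction I arbitrary: a b rule: finite_induct)
  case empty
  interpret b: Vector_Spaces.linear scale "(*)" b by (rule empty.prems(2))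
  have "b v = 0" for v
    using empty.prems(3)[of v] empty.prems(3)[of "- v"] b.neg[of v] by simp
  then show ?case by simp
next
  case (insert j I)
  interpret b: Vector_Spaces.linear scale "(*)" b by (rule insert.prems(2))
  interpret aj: Vector_Spaces.linear scale "(*)" "a j" by (rule insert.prems(1)) simp
  have lin: "Vector_Spaces.linear scale (*) (a i)" if "i \<in> I" for i
    using insert.prems(1) that by simp
  show ?case
  proof (cases "\<forall>v. (\<forall>i\<in>I. a i v \<le> 0 \<and> (i \<in> E \<longrightarrow> a i v = 0)) \<longrightarrow> b v \<le> 0")
    case True
    then have "\<exists>c. (\<forall>i\<in>I - E. 0 \<le> c i) \<and> (\<forall>v. b v = (\<Sum>i\<in>I. c i * a i v))"
      by (intro insert.IH lin insert.prems(2)) auto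
    then obtain c where c: "\<forall>i\<in>I - E. 0 \<le> c i" "\<And>v. b v = (\<Sum>i\<in>I. c i * a i v)"
      by blast
    have "(\<Sum>i\<in>I. (c(j := 0)) i * a i v) = (\<Sum>i\<in>I. c i * a i v)" for v
      using insert.hyps(2) by (intro sum.cong) auto
    then show ?thesis
      using c insert.hyps by (intro exI[of _ "c(j := 0)"]) auto
  next
    case False
    then obtain w where w: "\<And>i. i \<in> I \<Longrightarrow> a i w \<le> 0" "\<And>i. i \<in> I \<Longrightarrow> i \<in> E \<Longrightarrow> a i w = 0" "0 < b w"
      by (auto simp: not_le)
    \<comment> \<open>Otherwise \<open>w\<close> would satisfy all constraints, contrary to \<open>b w > 0\<close>.\<close>
    have jw: "a j w \<noteq> 0" "j \<notin> E \<Longrightarrow> 0 < a j w"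
      using insert.prems(3)[of w] w by force+
    \<comment> \<open>The projection along \<open>w\<close> onto the kernel of \<open>a j\<close>: composed with it, the remaining
      constraints imply \<open>b\<close> without the help of \<open>a j\<close>.\<close>
    define P where "P v = v - scale (a j v / a j w) w" for v
    have lin_P: "Vector_Spaces.linear scale (*) (\<lambda>v. f (P v))"
      and f_P: "\<And>v. f (P v) = f v - a j v / a j w * f w"
      if "Vector_Spaces.linear scale (*) f" for f
    proof -
      interpret f: Vector_Spaces.linear scale "(*)" f by (rule that)
      show *: "f (P v) = f v - a j v / a j w * f w" for v
        by (simp add: P_def f.diff f.scale)
      have lin_t: "Vector_Spaces.linear scale (*) (\<lambda>v. f v - a j v * t)" for t
        by unfold_locales
          (simp_all only: f.add f.scale aj.add aj.scale distrib_right right_diff_distrib mult.assoc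
            add_diff_add)
      show "Vector_Spaces.linear scale (*) (\<lambda>v. f (P v))"
        using lin_t[of "f w / a j w"] unfolding * times_divide_eq_left times_divide_eq_right .
    qed
    have "b (P v) \<le> 0" if "\<forall>i\<in>I. a i (P v) \<le> 0 \<and> (i \<in> E \<longrightarrow> a i (P v) = 0)" for v
      using that insert.prems(3)[of "P v"] f_P[OF insert.prems(1), of j v] jw by simp
    then have "\<exists>c. (\<forall>i\<in>I - E. 0 \<le> c i) \<and> (\<forall>v. b (P v) = (\<Sum>i\<in>I. c i * a i (P v)))"
      by (intro insert.IH lin_P lin insert.prems(2))
    then obtain c where c: "\<forall>i\<in>I - E. 0 \<le> c i" "\<And>v. b (P v) = (\<Sum>i\<in>I. c i * a i (P v))"
      by blast
    \<comment> \<open>The coefficient that makes the new identity hold at \<open>w\<close>.\<close>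
    define d where "d = (b w - (\<Sum>i\<in>I. c i * a i w)) / a j w"
    have "(\<Sum>i\<in>I. c i * a i w) \<le> 0"
    proof (intro sum_nonpos)
      fix i assume "i \<in> I"
      then show "c i * a i w \<le> 0"
        using c(1) w(1,2)[of i] by (cases "i \<in> E") (auto intro: mult_nonneg_nonpos)
    qed
    then have "0 \<le> d" if "j \<notin> E"
      using jw(2)[OF that] w(3) by (simp add: d_def)
    moreover have "b v = d * a j v + (\<Sum>i\<in>I. c i * a i v)" for v
    proof -
      have "b v - a j v / a j w * b w = (\<Sum>i\<in>I. c i * (a i v - a j v / a j w * a i w))"
        using c(2)[of v] f_P[OF insert.prems(2)] f_P[OF lin] by simp
      also have "\<dots> = (\<Sum>i\<in>I. c i * a i v) - a j v / a j w * (\<Sum>i\<in>I. c i * a i w)"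
        by (simp only: right_diff_distrib sum_subtractf sum_distrib_left mult.left_commute)
      finally have "b v = a j v / a j w * (b w - (\<Sum>i\<in>I. c i * a i w)) + (\<Sum>i\<in>I. c i * a i v)"
        by (simp only: right_diff_distrib diff_eq_eq)
      then show ?thesis
        by (simp add: d_def mult.commute)
    qed
    moreover have "(\<Sum>i\<in>I. (c(j := d)) i * a i v) = (\<Sum>i\<in>I. c i * a i v)" for v
      using insert.hyps(2) by (intro sum.cong) auto
    ultimately show ?thesis
      using c(1) insert.hyps by (intro exI[of _ "c(j := d)"]) auto
  qed
qed

section \<open>Multipliers for linear programs over a box\<close>

text \<open>
  A direction that does not leave the box at the bounds attained by \<open>z\<close> can be followed for a
  positive distance, since the other bounds hold strictly at \<open>z\<close> and there are finitely many.
\<close>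

lemma eventually_in_box:
  fixes z u cap :: "'k \<Rightarrow> real"
  assumes "finite K" and "\<And>k. k \<in> K \<Longrightarrow> 0 \<le> z k \<and> z k \<le> cap k"
    and "\<And>k. k \<in> K \<Longrightarrow> z k = 0 \<Longrightarrow> 0 \<le> u k"
    and "\<And>k. k \<in> K \<Longrightarrow> z k = cap k \<Longrightarrow> u k \<le> 0"
  shows "\<forall>\<^sub>F e in at_right 0. \<forall>k\<in>K. 0 \<le> z k + e * u k \<and> z k + e * u k \<le> cap k"
proof (intro eventually_ball_finite ballI eventually_conj)
  fix k assume k: "k \<in> K"
  have lim: "((\<lambda>e. z k + e * u k) \<longlongrightarrow> z k) (at_right 0)"
    by (auto intro!: tendsto_eq_intros)
  have pos: "\<forall>\<^sub>F e::real in at_right 0. 0 < e"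
    by (simp add: eventually_at_right_less)
  show "\<forall>\<^sub>F e in at_right 0. 0 \<le> z k + e * u k"
  proof (cases "z k = 0")
    case True
    then show ?thesis using pos assms(3)[OF k] by (auto elim!: eventually_mono)
  next
    case False
    then have "0 < z k" using assms(2)[OF k] by simp
    from order_tendstoD(1)[OF lim this] show ?thesis by (auto elim!: eventually_mono)
  qed
  show "\<forall>\<^sub>F e in at_right 0. z k + e * u k \<le> cap k"
  proof (cases "z k = cap k")
    case True
    then show ?thesis using pos assms(4)[OF k]
      by (auto elim!: eventually_mono simp: mult_nonneg_nonpos)
  next
    case False
    then have "z k < cap k" using assms(2)[OF k] by simp
    from order_tendstoD(2)[OF lim this] show ?thesis by (auto elim!: eventually_mono)
  qed
qed (fact assms(1))

lemma linear_weighted_sum: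
  "Vector_Spaces.linear (\<lambda>c (v::'k \<Rightarrow> real) k. c * v k) (*) (\<lambda>v. \<Sum>k\<in>K. w k * v k)"
  by unfold_locales
    (auto simp: fun_eq_iff algebra_simps sum.distrib sum_distrib_left)

text \<open>
  Complementary slackness for a linear program whose inequalities are only those of a box.
  The cone of feasible directions at the optimum \<open>z\<close> is cut out by the equations \<open>A\<close> and by the
  signs of the coordinates at which \<open>z\<close> attains a bound; by optimality \<open>w\<close> is nonpositive on it.
  Farkas' lemma represents \<open>w\<close> through these constraints, which says that the reduced
  objective \<open>w + A\<^sup>T \<pi>\<close> vanishes in the coordinates strictly between the bounds and is
  nonpositive at the lower and nonnegative at the upper bound, with either sign where these coincide.
\<close>

lemma box_lp_multipliers:
  fixes A :: "'c \<Rightarrow> 'k \<Rightarrow> real" and w cap z :: "'k \<Rightarrow> real"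
  assumes K: "finite K" and C: "finite C"
    and box: "\<And>k. k \<in> K \<Longrightarrow> 0 \<le> z k \<and> z k \<le> cap k"
    and feas: "\<And>c. c \<in> C \<Longrightarrow> (\<Sum>k\<in>K. A c k * z k) = 0"
    and opt: "\<And>v. (\<And>k. k \<in> K \<Longrightarrow> 0 \<le> v k \<and> v k \<le> cap k) \<Longrightarrow>
      (\<And>c. c \<in> C \<Longrightarrow> (\<Sum>k\<in>K. A c k * v k) = 0) \<Longrightarrow>
      (\<Sum>k\<in>K. w k * v k) \<le> (\<Sum>k\<in>K. w k * z k)"
  obtains \<pi> where
    "\<And>k. k \<in> K \<Longrightarrow> 0 < w k + (\<Sum>c\<in>C. \<pi> c * A c k) \<Longrightarrow> z k = cap k"
    "\<And>k. k \<in> K \<Longrightarrow> w k + (\<Sum>c\<in>C. \<pi> c * A c k) < 0 \<Longrightarrow> z k = 0"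
proof -
  define T where "T = {k \<in> K. z k = 0 \<or> z k = cap k}"
  define a where "a i v = (case i of Inl c \<Rightarrow> \<Sum>k\<in>K. A c k * v k
    | Inr k \<Rightarrow> (if z k = 0 then - v k else v k))" for i and v :: "'k \<Rightarrow> real"
  \<comment> \<open>A coordinate of zero capacity attains both bounds, so its direction is fixed to zero.\<close>
  define E where "E = Inl ` C \<union> Inr ` {k. cap k = 0}"
  have T: "finite T" "T \<subseteq> K" using K by (auto simp: T_def)
  have coord: "Vector_Spaces.linear (\<lambda>c (v::'k \<Rightarrow> real) k. c * v k) (*) (\<lambda>v. s * v k)" for s k
    using linear_weighted_sum[of "\<lambda>_. s" "{k}"] by simp
  have lin: "Vector_Spaces.linear (\<lambda>c v k. c * v k) (*) (a i)" if "i \<in> C <+> T" for i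
  proof (cases i)
    case (Inl c)
    then show ?thesis using linear_weighted_sum[of "A c" K] by (simp add: a_def[abs_def])
  next
    case (Inr k)
    then show ?thesis using coord[of "if z k = 0 then - 1 else 1" k]
      by (cases "z k = 0") (simp_all add: a_def[abs_def])
  qed
  have ascent: "(\<Sum>k\<in>K. w k * u k) \<le> 0"
    if u: "\<forall>i\<in>C <+> T. a i u \<le> 0 \<and> (i \<in> E \<longrightarrow> a i u = 0)" for u
  proof -
    have uC: "(\<Sum>k\<in>K. A c k * u k) = 0" if "c \<in> C" for c
      using u that by (auto simp: a_def E_def)
    have uT: "(z k = 0 \<longrightarrow> 0 \<le> u k) \<and> (z k = cap k \<longrightarrow> u k \<le> 0)" if "k \<in> K" for k
      using u[rule_format, of "Inr k"] that by (auto simp: a_def E_def T_def InrI split: if_splits)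
    have "\<forall>\<^sub>F e in at_right 0. (\<forall>k\<in>K. 0 \<le> z k + e * u k \<and> z k + e * u k \<le> cap k) \<and> 0 < e"
      using uT box by (intro eventually_conj eventually_in_box[OF K])
        (auto simp: eventually_at_right_less)
    then obtain e where e: "\<And>k. k \<in> K \<Longrightarrow> 0 \<le> z k + e * u k \<and> z k + e * u k \<le> cap k" "0 < e"
      using eventually_happens'[OF trivial_limit_at_right_real] by blast
    have expand: "(\<Sum>k\<in>K. f k * (z k + e * u k)) = (\<Sum>k\<in>K. f k * z k) + e * (\<Sum>k\<in>K. f k * u k)"
      for f by (simp add: distrib_left sum.distrib sum_distrib_left mult_ac)
    have "(\<Sum>k\<in>K. w k * (z k + e * u k)) \<le> (\<Sum>k\<in>K. w k * z k)"
      by (rule opt) (auto simp: e(1) expand feas uC)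
    then have "e * (\<Sum>k\<in>K. w k * u k) \<le> 0" by (simp add: expand)
    then show ?thesis using e(2) by (simp add: mult_le_0_iff)
  qed
  have "\<exists>r. (\<forall>i\<in>(C <+> T) - E. 0 \<le> r i) \<and>
      (\<forall>v. (\<Sum>k\<in>K. w k * v k) = (\<Sum>i\<in>C <+> T. r i * a i v))"
  proof (rule farkas[OF _ lin linear_weighted_sum])
    show "finite (C <+> T)" using C T(1) by simp
  qed (use ascent in auto)
  then obtain r where r: "\<forall>i\<in>(C <+> T) - E. 0 \<le> r i"
    and w: "\<forall>v. (\<Sum>k\<in>K. w k * v k) = (\<Sum>i\<in>C <+> T. r i * a i v)"
    by (elim exE conjE)
  have red: "w k + (\<Sum>c\<in>C. - r (Inl c) * A c k)
      = (if k \<in> T then r (Inr k) * (if z k = 0 then - 1 else 1) else 0)" if k: "k \<in> K" for k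
  proof -
    have pick: "(\<Sum>l\<in>S. f l * (if l = k then 1 else 0)) = (if k \<in> S then f k else 0)"
      if "finite S" for S and f :: "'k \<Rightarrow> real"
      using that by (simp add: if_distrib[of "(*) x" for x] cong: if_cong)
    \<comment> \<open>Evaluating the identity \<open>w\<close> at the unit vector of \<open>k\<close> reads off the \<open>k\<close>-th coefficient.\<close>
    have "w k = (\<Sum>l\<in>K. w l * (if l = k then 1 else 0))"
      using k by (simp add: pick[OF K])
    also have "\<dots> = (\<Sum>c\<in>C. r (Inl c) * a (Inl c) (\<lambda>l. if l = k then 1 else 0))
        + (\<Sum>l\<in>T. r (Inr l) * a (Inr l) (\<lambda>l. if l = k then 1 else 0))"
      unfolding w[rule_format] using C T(1) by (simp add: sum.Plus)
    also have "(\<Sum>c\<in>C. r (Inl c) * a (Inl c) (\<lambda>l. if l = k then 1 else 0))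
        = (\<Sum>c\<in>C. r (Inl c) * A c k)"
      using k by (simp add: a_def pick[OF K])
    also have "(\<Sum>l\<in>T. r (Inr l) * a (Inr l) (\<lambda>l. if l = k then 1 else 0))
        = (\<Sum>l\<in>T. if l = k then r (Inr k) * (if z k = 0 then - 1 else 1) else 0)"
      by (intro sum.cong) (auto simp: a_def)
    also have "\<dots> = (if k \<in> T then r (Inr k) * (if z k = 0 then - 1 else 1) else 0)"
      using T(1) by (simp add: sum.delta)
    finally show ?thesis by (simp add: sum_negf)
  qed
  have sgn: "0 \<le> r (Inr k)" if "k \<in> T" "cap k \<noteq> 0" for k
    using that by (intro r[rule_format]) (auto simp: E_def)
  show thesis
  proof (rule that[of "\<lambda>c. - r (Inl c)"])
    fix k assume k: "k \<in> K" and "0 < w k + (\<Sum>c\<in>C. - r (Inl c) * A c k)"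
    then show "z k = cap k"
      unfolding red[OF k] using sgn[of k] box[OF k]
      by (cases "cap k = 0") (auto simp: T_def split: if_splits)
  next
    fix k assume k: "k \<in> K" and "w k + (\<Sum>c\<in>C. - r (Inl c) * A c k) < 0"
    then show "z k = 0"
      unfolding red[OF k] using sgn[of k] box[OF k]
      by (cases "cap k = 0") (auto simp: T_def split: if_splits)
  qed
qed

section \<open>The market as a single family of players\<close>

type_synonym ('g, 'd, 'l, 'm) player = "('g + 'd) + ('l + 'm)"

definition players ::
  "('n, 't::linorder, 'p, 'g, 'd, 'l, 'm) scst_data \<Rightarrow> ('g, 'd, 'l, 'm) player set" where
  "players M = (suppliers M <+> consumers M) <+> (transports M <+> technologies M)"

abbreviation by_kind ::
  "('g \<Rightarrow> 'r) \<Rightarrow> ('d \<Rightarrow> 'r) \<Rightarrow> ('l \<Rightarrow> 'r) \<Rightarrow> ('m \<Rightarrow> 'r) \<Rightarrow> ('g, 'd, 'l, 'm) player \<Rightarrow> 'r" where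
  "by_kind a b c d \<equiv> case_sum (case_sum a b) (case_sum c d)"

definition cap ::
  "('n, 't::linorder, 'p, 'g, 'd, 'l, 'm) scst_data \<Rightarrow> ('g, 'd, 'l, 'm) player \<Rightarrow> real" where
  "cap M = by_kind (sup_cap M) (con_cap M) (tra_cap M) (tec_cap M)"

definition flow :: "('g, 'd, 'l, 'm) allocation \<Rightarrow> ('g, 'd, 'l, 'm) player \<Rightarrow> real" where
  "flow x = by_kind (sup_flow x) (con_flow x) (tra_flow x) (tec_flow x)"

definition mult :: "('g, 'd, 'l, 'm) multipliers \<Rightarrow> ('g, 'd, 'l, 'm) player \<Rightarrow> real" where
  "mult y = by_kind (sup_mult y) (con_mult y) (tra_mult y) (tec_mult y)"

text \<open>
  Profit per unit of flow.  At zero prices only the bids remain, with the signs that they have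
  in the primal objective.
\<close>

definition margin ::
  "('n, 't::linorder, 'p, 'g, 'd, 'l, 'm) scst_data \<Rightarrow> ('n, 't, 'p) prices
     \<Rightarrow> ('g, 'd, 'l, 'm) player \<Rightarrow> real" where
  "margin M \<pi> = by_kind (\<lambda>i. sup_price M \<pi> i - sup_bid M i) (\<lambda>j. con_bid M j - con_price M \<pi> j)
     (\<lambda>l. tra_price M \<pi> l - tra_bid M l) (\<lambda>m. tec_price M \<pi> m - tec_bid M m)"

text \<open>
  The coefficients of the clearing constraints, written as supply minus demand.  They are
  differences of indicators, since a transport provider may have the same base and receiving node, and a
  technology may generate a product that it also consumes.
\<close>

definition net_supply ::
  "('n, 't::linorder, 'p, 'g, 'd, 'l, 'm) scst_data \<Rightarrow> ('n \<times> 't) \<times> 'p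
     \<Rightarrow> ('g, 'd, 'l, 'm) player \<Rightarrow> real" where
  "net_supply M = (\<lambda>(s, p). by_kind
     (\<lambda>i. if i \<in> sup_at M s p then 1 else 0)
     (\<lambda>j. - (if j \<in> con_at M s p then 1 else 0))
     (\<lambda>l. (if l \<in> tra_in M s p then 1 else 0) - (if l \<in> tra_out M s p then 1 else 0))
     (\<lambda>m. (if m \<in> tec_gen_at M s p then tec_yield M m p else 0)
        - (if m \<in> tec_con_at M s p then tec_yield M m p else 0)))"

lemma ex_flow: "\<exists>x. flow x = v"
proof
  show "flow \<lparr>sup_flow = v \<circ> Inl \<circ> Inl, con_flow = v \<circ> Inl \<circ> Inr,
    tra_flow = v \<circ> Inr \<circ> Inl, tec_flow = v \<circ> Inr \<circ> Inr\<rparr> = v"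
    by (auto simp: flow_def fun_eq_iff split: sum.split)
qed

lemma ex_mult: "\<exists>y. mult y = v"
proof
  show "mult \<lparr>sup_mult = v \<circ> Inl \<circ> Inl, con_mult = v \<circ> Inl \<circ> Inr,
    tra_mult = v \<circ> Inr \<circ> Inl, tec_mult = v \<circ> Inr \<circ> Inr\<rparr> = v"
    by (auto simp: mult_def fun_eq_iff split: sum.split)
qed

lemma ball_players:
  "(\<forall>k\<in>players M. Q k) \<longleftrightarrow>
     (\<forall>i\<in>suppliers M. Q (Inl (Inl i))) \<and> (\<forall>j\<in>consumers M. Q (Inl (Inr j))) \<and>
     (\<forall>l\<in>transports M. Q (Inr (Inl l))) \<and> (\<forall>m\<in>technologies M. Q (Inr (Inr m)))"
  unfolding players_def by blast

lemma within_capacity_iff: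
  "within_capacity M x \<longleftrightarrow> (\<forall>k\<in>players M. 0 \<le> flow x k \<and> flow x k \<le> cap M k)"
  by (simp add: within_capacity_def ball_players flow_def cap_def)

lemma dual_feasible_iff:
  "dual_feasible M (\<pi>, y) \<longleftrightarrow> (\<forall>k\<in>players M. 0 \<le> mult y k \<and> margin M \<pi> k \<le> mult y k)"
  by (auto simp: dual_feasible_def ball_players mult_def margin_def algebra_simps)

context scst
begin

lemma finite_players: "finite (players M)"
  by (simp add: players_def finite_suppliers finite_consumers finite_transports finite_technologies)

lemma sum_players:
  fixes f :: "_ \<Rightarrow> real"
  shows "(\<Sum>k\<in>players M. f k) =
    (\<Sum>i\<in>suppliers M. f (Inl (Inl i))) + (\<Sum>j\<in>consumers M. f (Inl (Inr j)))
    + (\<Sum>l\<in>transports M. f (Inr (Inl l))) + (\<Sum>m\<in>technologies M. f (Inr (Inr m)))"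
  by (simp add: players_def sum.Plus finite_suppliers finite_consumers finite_transports
      finite_technologies add.assoc)

lemma dual_objective_eq: "dual_objective M (\<pi>, y) = (\<Sum>k\<in>players M. cap M k * mult y k)"
  by (simp add: dual_objective_def sum_players cap_def mult_def)

lemma collective_profit_eq:
  "collective_profit M \<pi> x = (\<Sum>k\<in>players M. margin M \<pi> k * flow x k)"
  by (simp add: collective_profit_def sum_players margin_def flow_def sup_profit_def
      con_profit_def tra_profit_def tec_profit_def)

lemma primal_objective_eq:
  "primal_objective M x = (\<Sum>k\<in>players M. margin M (\<lambda>_ _. 0) k * flow x k)"
  by (simp add: primal_objective_def sum_players margin_def flow_def sup_price_def con_price_def
      tra_price_def tec_price_def sum_negf)

lemma clears_iff:
  "clears M x \<longleftrightarrow>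
     (\<forall>c\<in>st_nodes M \<times> products M. (\<Sum>k\<in>players M. net_supply M c k * flow x k) = 0)"
proof -
  have "(\<Sum>k\<in>players M. net_supply M (s, p) k * flow x k) =
    ((\<Sum>i\<in>sup_at M s p. sup_flow x i) + (\<Sum>l\<in>tra_in M s p. tra_flow x l)
          + (\<Sum>m\<in>tec_gen_at M s p. tec_yield M m p * tec_flow x m))
    - ((\<Sum>j\<in>con_at M s p. con_flow x j) + (\<Sum>l\<in>tra_out M s p. tra_flow x l)
          + (\<Sum>m\<in>tec_con_at M s p. tec_yield M m p * tec_flow x m))" for s p
  proof -
    have restrict: "(\<Sum>k\<in>B. f k) = (\<Sum>k\<in>A. if k \<in> B then f k else 0)"
      if "finite A" "B \<subseteq> A" for A B and f :: "'z \<Rightarrow> real"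
      using that by (simp add: sum.inter_restrict[symmetric] Int_absorb1)
    have "(\<Sum>i\<in>sup_at M s p. sup_flow x i) = (\<Sum>i\<in>suppliers M. if i \<in> sup_at M s p then sup_flow x i else 0)"
      "(\<Sum>j\<in>con_at M s p. con_flow x j) = (\<Sum>j\<in>consumers M. if j \<in> con_at M s p then con_flow x j else 0)"
      "(\<Sum>l\<in>tra_in M s p. tra_flow x l) = (\<Sum>l\<in>transports M. if l \<in> tra_in M s p then tra_flow x l else 0)"
      "(\<Sum>l\<in>tra_out M s p. tra_flow x l) = (\<Sum>l\<in>transports M. if l \<in> tra_out M s p then tra_flow x l else 0)"
      "(\<Sum>m\<in>tec_gen_at M s p. tec_yield M m p * tec_flow x m) =
         (\<Sum>m\<in>technologies M. if m \<in> tec_gen_at M s p then tec_yield M m p * tec_flow x m else 0)"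
      "(\<Sum>m\<in>tec_con_at M s p. tec_yield M m p * tec_flow x m) =
         (\<Sum>m\<in>technologies M. if m \<in> tec_con_at M s p then tec_yield M m p * tec_flow x m else 0)"
      by (rule restrict; auto simp: finite_suppliers finite_consumers finite_transports
          finite_technologies sup_at_def con_at_def tra_in_def tra_out_def tec_gen_at_def tec_con_at_def)+
    then show ?thesis
      by (simp add: sum_players net_supply_def flow_def left_diff_distrib sum_subtractf sum_negf[symmetric]
          if_distrib[of "\<lambda>y. y * _"] if_distrib[of uminus] cong: if_cong)
  qed
  then show ?thesis by (auto simp: clears_def)
qed

lemma finite_clearing_index: "finite (st_nodes M \<times> products M)"
  by (simp add: st_nodes_def finite_spatial_nodes finite_times finite_products)

text \<open>
  The stakeholder prices are the columns of the clearing constraints paired with the prices: this is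
  what makes the collective profit a Lagrangian.  It depends on the nodes and products of all players
  lying in the index set of the clearing constraints, for otherwise a player could earn a
  price that no constraint accounts for.
\<close>

lemma margin_eq:
  assumes "k \<in> players M"
  shows "margin M \<pi> k = margin M (\<lambda>_ _. 0) k
    + (\<Sum>c\<in>st_nodes M \<times> products M. \<pi> (fst c) (snd c) * net_supply M c k)"
proof -
  let ?C = "st_nodes M \<times> products M"
  have C: "finite ?C" by (rule finite_clearing_index)
  \<comment> \<open>A player trading a single product at a single node collects one summand.\<close>
  have at: "(\<Sum>c\<in>?C. \<pi> (fst c) (snd c) * (if s = fst c \<and> p = snd c then 1 else 0)) = \<pi> s p"
    if "s \<in> st_nodes M" "p \<in> products M" for s p
  proof -
    have "(\<Sum>c\<in>?C. \<pi> (fst c) (snd c) * (if s = fst c \<and> p = snd c then 1 else 0))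
      = (\<Sum>c\<in>?C. if c = (s, p) then \<pi> s p else 0)"
      by (intro sum.cong) auto
    then show ?thesis using C that by (simp add: sum.delta)
  qed
  have basket: "(\<Sum>c\<in>?C. \<pi> (fst c) (snd c) * (if s = fst c \<and> snd c \<in> B then f (snd c) else 0))
      = (\<Sum>p\<in>B. f p * \<pi> s p)"
    if "s \<in> st_nodes M" "B \<subseteq> products M" for s B and f :: "_ \<Rightarrow> real"
  proof -
    have singleton_times: "{s} \<times> B = Pair s ` B" by auto
    have "(\<Sum>c\<in>?C. \<pi> (fst c) (snd c) * (if s = fst c \<and> snd c \<in> B then f (snd c) else 0))
      = (\<Sum>c\<in>{s} \<times> B. \<pi> (fst c) (snd c) * f (snd c))"
      using C that by (intro sum.mono_neutral_cong_right) auto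
    also have "\<dots> = (\<Sum>p\<in>B. f p * \<pi> s p)"
      using sum.reindex[of "Pair s" B "\<lambda>c. \<pi> (fst c) (snd c) * f (snd c)"]
      by (simp add: inj_on_def singleton_times mult.commute)
    finally show ?thesis .
  qed
  show ?thesis
    using assms unfolding players_def
    by (auto simp: margin_def sup_price_def con_price_def tra_price_def tec_price_def net_supply_def
        split_beta sup_at_def con_at_def tra_in_def tra_out_def tec_gen_at_def tec_con_at_def
        right_diff_distrib sum_subtractf sum_negf at basket sup_node_in sup_prod_in con_node_in con_prod_in
        base_node_in recv_node_in tra_prod_in tec_node_in tec_con_subset tec_gen_subset)
qed

text \<open>Payments between the players cancel once each net supply is zero.\<close>

lemma collective_profit_of_clearing:
  assumes "clears M x"
  shows "collective_profit M \<pi> x = primal_objective M x"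
proof -
  let ?C = "st_nodes M \<times> products M"
  have "collective_profit M \<pi> x = primal_objective M x
      + (\<Sum>k\<in>players M. \<Sum>c\<in>?C. \<pi> (fst c) (snd c) * (net_supply M c k * flow x k))"
    by (simp add: collective_profit_eq primal_objective_eq margin_eq[of _ \<pi>] distrib_right
        sum.distrib sum_distrib_right mult.assoc)
  also have "(\<Sum>k\<in>players M. \<Sum>c\<in>?C. \<pi> (fst c) (snd c) * (net_supply M c k * flow x k))
      = (\<Sum>c\<in>?C. \<pi> (fst c) (snd c) * (\<Sum>k\<in>players M. net_supply M c k * flow x k))"
    by (subst sum.swap) (simp add: sum_distrib_left)
  also have "\<dots> = 0"
    using assms by (simp add: clears_iff del: split_paired_Ball_Sigma)
  finally show ?thesis by simp
qed

text \<open>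
  Weak duality for the Lagrangian: a flow between zero and capacity earns at most capacity times
  multiplier, player by player.
\<close>

lemma collective_profit_le_dual:
  assumes "within_capacity M z" "dual_feasible M (\<pi>, y)"
  shows "collective_profit M \<pi> z \<le> dual_objective M (\<pi>, y)"
  unfolding collective_profit_eq dual_objective_eq
proof (rule sum_mono)
  fix k assume k: "k \<in> players M"
  then have z: "0 \<le> flow z k" "flow z k \<le> cap M k" and y: "0 \<le> mult y k" "margin M \<pi> k \<le> mult y k"
    using assms by (auto simp: within_capacity_iff dual_feasible_iff)
  have "margin M \<pi> k * flow z k \<le> mult y k * flow z k" using y z by (intro mult_right_mono)
  also have "\<dots> \<le> mult y k * cap M k" using y z by (intro mult_left_mono)
  finally show "margin M \<pi> k * flow z k \<le> cap M k * mult y k" by (simp add: mult.commute)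
qed

text \<open>
  Strong duality.  With the positive parts of the margins as multipliers, complementary slackness
  makes the dual objective equal to the collective profit player by player.
\<close>

lemma dual_attains_primal:
  assumes "primal_optimal M x"
  shows "\<exists>\<pi> y. dual_feasible M (\<pi>, y) \<and> dual_objective M (\<pi>, y) = primal_objective M x"
proof -
  let ?C = "st_nodes M \<times> products M"
  have x: "within_capacity M x" "clears M x"
    and opt: "\<And>v. within_capacity M v \<Longrightarrow> clears M v \<Longrightarrow> primal_objective M v \<le> primal_objective M x"
    using assms by (auto simp: primal_optimal_def is_arg_max_linorder primal_feasible_def)
  obtain q where q:
    "\<And>k. k \<in> players M \<Longrightarrow>
      0 < margin M (\<lambda>_ _. 0) k + (\<Sum>c\<in>?C. q c * net_supply M c k) \<Longrightarrow> flow x k = cap M k"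
    "\<And>k. k \<in> players M \<Longrightarrow>
      margin M (\<lambda>_ _. 0) k + (\<Sum>c\<in>?C. q c * net_supply M c k) < 0 \<Longrightarrow> flow x k = 0"
  proof (rule box_lp_multipliers[OF finite_players finite_clearing_index,
        of "flow x" "cap M" "net_supply M" "margin M (\<lambda>_ _. 0)"])
    show "\<And>k. k \<in> players M \<Longrightarrow> 0 \<le> flow x k \<and> flow x k \<le> cap M k"
      using x(1) by (simp add: within_capacity_iff)
    show "\<And>c. c \<in> ?C \<Longrightarrow> (\<Sum>k\<in>players M. net_supply M c k * flow x k) = 0"
      using x(2) clears_iff by blast
    fix v
    assume v: "\<And>k. k \<in> players M \<Longrightarrow> 0 \<le> v k \<and> v k \<le> cap M k"
      "\<And>c. c \<in> ?C \<Longrightarrow> (\<Sum>k\<in>players M. net_supply M c k * v k) = 0"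
    obtain v' where v': "flow v' = v" using ex_flow by blast
    have "within_capacity M v'" "clears M v'"
      unfolding within_capacity_iff clears_iff v' using v by blast+
    from opt[OF this]
    show "(\<Sum>k\<in>players M. margin M (\<lambda>_ _. 0) k * v k)
        \<le> (\<Sum>k\<in>players M. margin M (\<lambda>_ _. 0) k * flow x k)"
      by (simp add: primal_objective_eq v')
  qed blast
  define \<pi> where "\<pi> s p = q (s, p)" for s p
  have q': "flow x k = cap M k" if "k \<in> players M" "0 < margin M \<pi> k" for k
    using q(1)[OF that(1)] that(2) by (simp add: margin_eq[OF that(1), of \<pi>] \<pi>_def)
  have q'': "flow x k = 0" if "k \<in> players M" "margin M \<pi> k < 0" for k
    using q(2)[OF that(1)] that(2) by (simp add: margin_eq[OF that(1), of \<pi>] \<pi>_def)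
  obtain y where y: "mult y = (\<lambda>k. max 0 (margin M \<pi> k))" using ex_mult by blast
  have "dual_feasible M (\<pi>, y)" by (simp add: dual_feasible_iff y)
  moreover have "dual_objective M (\<pi>, y) = collective_profit M \<pi> x"
    unfolding dual_objective_eq collective_profit_eq
  proof (rule sum.cong)
    fix k assume "k \<in> players M"
    then show "cap M k * mult y k = margin M \<pi> k * flow x k"
      using q'[of k] q''[of k] by (cases "margin M \<pi> k" "0::real" rule: linorder_cases) (auto simp: y)
  qed simp
  ultimately show ?thesis using collective_profit_of_clearing[OF x(2)] by metis
qed

text \<open>Otherwise idling player \<open>k\<close> alone would stay within capacity and raise the collective profit.\<close>

lemma profit_nonneg:
  assumes opt: "is_arg_max (collective_profit M \<pi>) (within_capacity M) x" and k: "k \<in> players M"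
  shows "0 \<le> margin M \<pi> k * flow x k"
proof -
  obtain z where z: "flow z = (flow x)(k := 0)" using ex_flow by blast
  have "within_capacity M z"
    using opt unfolding is_arg_max_linorder within_capacity_iff z by (auto intro: order_trans)
  then have "collective_profit M \<pi> z \<le> collective_profit M \<pi> x"
    using opt by (simp add: is_arg_max_linorder)
  moreover have "(\<Sum>i\<in>players M - {k}. margin M \<pi> i * flow z i)
      = (\<Sum>i\<in>players M - {k}. margin M \<pi> i * flow x i)"
    by (intro sum.cong) (auto simp: z)
  ultimately show ?thesis
    using k by (simp add: collective_profit_eq sum.remove[OF finite_players k] z)
qed

end

theorem theorem1:
  fixes M :: "('n, 't::linorder, 'p, 'g, 'd, 'l, 'm) scst_data"
    and x :: "('g, 'd, 'l, 'm) allocation"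
    and \<pi> :: "('n, 't, 'p) prices"
    and y :: "('g, 'd, 'l, 'm) multipliers"
  assumes "scst M"
    and "primal_optimal M x"
    and "dual_optimal M (\<pi>, y)"
  shows "is_arg_max (collective_profit M \<pi>) (within_capacity M) x \<and>
         (\<forall>i\<in>suppliers M. 0 \<le> sup_profit M \<pi> x i) \<and>
         (\<forall>j\<in>consumers M. 0 \<le> con_profit M \<pi> x j) \<and>
         (\<forall>l\<in>transports M. 0 \<le> tra_profit M \<pi> x l) \<and>
         (\<forall>m\<in>technologies M. 0 \<le> tec_profit M \<pi> x m)"
proof -
  interpret scst M by (rule assms(1))
  have x: "within_capacity M x" "clears M x"
    using assms(2) by (auto simp: primal_optimal_def is_arg_max_linorder primal_feasible_def)
  have y: "dual_feasible M (\<pi>, y)" "dual_objective M (\<pi>, y) \<le> primal_objective M x"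
    using assms(3) dual_attains_primal[OF assms(2)]
    unfolding dual_optimal_def is_arg_min_linorder by metis+
  have "collective_profit M \<pi> z \<le> collective_profit M \<pi> x" if "within_capacity M z" for z
    using collective_profit_le_dual[OF that y(1)] y(2) collective_profit_of_clearing[OF x(2)]
    by simp
  then have max: "is_arg_max (collective_profit M \<pi>) (within_capacity M) x"
    using x(1) by (simp add: is_arg_max_linorder)
  from profit_nonneg[OF this] have "\<forall>k\<in>players M. 0 \<le> margin M \<pi> k * flow x k" by blast
  then show ?thesis
    using max by (simp add: ball_players margin_def flow_def sup_profit_def con_profit_def
        tra_profit_def tec_profit_def)
qed

end
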